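(* In the one-dimensional setting of the context, assume in addition that the walk is uniformly elliptic and $\mathbb{E}[\log(p^-/p^+)]\le0$. Then for all $x\in[-1,1]$, $I(x)=J(x)$, where $$I(x)=\sup_{\lambda\in\mathbb{R}}\{\lambda x-\Lambda(\lambda)\},\qquad J(x)=\begin{cases}\sup_{r\in\mathbb{R}}\{r-x\,g(r)\}, & 0\le x\le1,\\ \sup_{r\in\mathbb{R}}\{r+x\,h(r)\}, & -1\le x\le 0.\end{cases}$$
   Context: Let $(\Omega,\mathcal{F},\mathbb{P})$ be a probability space with an invertible ergodic measure-preserving transformation $T$, and $p^+,p^-:\Omega\to[0,1]$ measurable with $p^++p^-=1$; uniform ellipticity means $0<a\le p^{\pm}\le b<1$ $\mathbb{P}$-a.s. for constants $a,b$. $P_\omega$ is the law of the walk $(X_n)$ on $\mathbb{Z}$, $X_0=0$, stepping from $x$ to $x+1$ with probability $p^+(T^x\omega)$ and to $x-1$ with probability $p^-(T^x\omega)$. Let $\tau_1=\inf\{n:X_n=1\}$, $\tau_{-1}=\inf\{n:X_n=-1\}$, $G(\omega,r)=E^{P_\omega}[\mathrm{e}^{r\tau_1}1_{\{\tau_1<\infty\}}]$, $H(\omega,r)=E^{P_\omega}[\mathrm{e}^{r\tau_{-1}}1_{\{\tau_{-1}<\infty\}}]$, $g(r)=\mathbb{E}[\log G(\omega,r)]$, $h(r)=\mathbb{E}[\log H(\omega,r)]$. The class $\mathcal{K}$ consists of pairs $F^\pm\in L^1(\mathbb{P})$ with $\mathbb{E}[F^\pm]=0$ and $F^+(\omega)+F^-(T\omega)=0$,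 and $$\Lambda(\lambda)=\inf_{F\in\mathcal{K}}\operatorname*{ess\,sup}_\omega\log\left\{p^+\mathrm{e}^{\lambda+F^+}+p^-\mathrm{e}^{-\lambda+F^-}\right\}.$$ *)

theory Defs
  imports "HOL-Probability.Probability"
begin

definition invertible_mp :: "'w measure \<Rightarrow> ('w \<Rightarrow> 'w) \<Rightarrow> bool" where
  "invertible_mp M T \<longleftrightarrow>
     bij_betw T (space M) (space M) \<and>
     T \<in> M \<rightarrow>\<^sub>M M \<and>
     the_inv_into (space M) T \<in> M \<rightarrow>\<^sub>M M \<and>
     distr M M T = M"

definition ergodic :: "'w measure \<Rightarrow> ('w \<Rightarrow> 'w) \<Rightarrow> bool" where
  "ergodic M T \<longleftrightarrow>
     (\<forall>A \<in> sets M. T -` A \<inter> space M = A \<longrightarrow> measure M A = 0 \<or> measure M A = 1)"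

definition Tpow :: "'w measure \<Rightarrow> ('w \<Rightarrow> 'w) \<Rightarrow> int \<Rightarrow> 'w \<Rightarrow> 'w" where
  "Tpow M T x = (if 0 \<le> x then T ^^ nat x else the_inv_into (space M) T ^^ nat (- x))"

definition walk_pos :: "bool list \<Rightarrow> nat \<Rightarrow> int" where
  "walk_pos s k = (\<Sum>i<k. if s ! i then 1 else -1)"

definition path_prob ::
  "'w measure \<Rightarrow> ('w \<Rightarrow> 'w) \<Rightarrow> ('w \<Rightarrow> real) \<Rightarrow> ('w \<Rightarrow> real) \<Rightarrow> 'w \<Rightarrow> bool list \<Rightarrow> real" where
  "path_prob M T pp pm \<omega> s =
     (\<Prod>k<length s. if s ! k then pp (Tpow M T (walk_pos s k) \<omega>)
                               else pm (Tpow M T (walk_pos s k) \<omega>))"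

text \<open>P_omega(tau_y = n), where tau_y = inf{n : X_n = y} (y = 1 or y = -1).\<close>
definition hit_prob ::
  "'w measure \<Rightarrow> ('w \<Rightarrow> 'w) \<Rightarrow> ('w \<Rightarrow> real) \<Rightarrow> ('w \<Rightarrow> real) \<Rightarrow> int \<Rightarrow> 'w \<Rightarrow> nat \<Rightarrow> real" where
  "hit_prob M T pp pm y \<omega> n =
     (\<Sum>s \<in> {s. length s = n \<and> walk_pos s n = y \<and> (\<forall>k<n. walk_pos s k \<noteq> y)}.
        path_prob M T pp pm \<omega> s)"

text \<open>E^{P_omega}[exp(r tau_y) 1_{tau_y < infinity}], possibly infinite.\<close>
definition hit_mgf ::
  "'w measure \<Rightarrow> ('w \<Rightarrow> 'w) \<Rightarrow> ('w \<Rightarrow> real) \<Rightarrow> ('w \<Rightarrow> real) \<Rightarrow> int \<Rightarrow> 'w \<Rightarrow> real \<Rightarrow> ennreal" where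
  "hit_mgf M T pp pm y \<omega> r = (\<Sum>n. ennreal (exp (r * real n) * hit_prob M T pp pm y \<omega> n))"

definition elog :: "ennreal \<Rightarrow> ereal" where
  "elog z = (if z = \<infinity> then \<infinity> else if z = 0 then - \<infinity> else ereal (ln (enn2real z)))"

definition eexpect :: "'w measure \<Rightarrow> ('w \<Rightarrow> ereal) \<Rightarrow> ereal" where
  "eexpect M X = enn2ereal (\<integral>\<^sup>+ \<omega>. e2ennreal (max (X \<omega>) 0) \<partial>M)
               - enn2ereal (\<integral>\<^sup>+ \<omega>. e2ennreal (max (- X \<omega>) 0) \<partial>M)"

definition g_fun where
  "g_fun M T pp pm r = eexpect M (\<lambda>\<omega>. elog (hit_mgf M T pp pm 1 \<omega> r))"

definition h_fun where
  "h_fun M T pp pm r = eexpect M (\<lambda>\<omega>. elog (hit_mgf M T pp pm (-1) \<omega> r))"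

definition class_K :: "'w measure \<Rightarrow> ('w \<Rightarrow> 'w) \<Rightarrow> (('w \<Rightarrow> real) \<times> ('w \<Rightarrow> real)) set" where
  "class_K M T = {(Fp, Fm). integrable M Fp \<and> integrable M Fm \<and>
      integral\<^sup>L M Fp = 0 \<and> integral\<^sup>L M Fm = 0 \<and>
      (AE \<omega> in M. Fp \<omega> + Fm (T \<omega>) = 0)}"

definition Lambda where
  "Lambda M T pp pm l =
     (INF F \<in> class_K M T. esssup M (\<lambda>\<omega>. ereal (ln (pp \<omega> * exp (l + fst F \<omega>)
                                                + pm \<omega> * exp (- l + snd F \<omega>)))))"

definition I_rate where
  "I_rate M T pp pm x = (SUP l. ereal (l * x) - Lambda M T pp pm l)"

text \<open>Convention: r - x g(r) is read as -infinity when g(r) = +infinity (also for x = 0).\<close>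
definition J_rate where
  "J_rate M T pp pm x =
     (if 0 \<le> x then Sup {ereal r - ereal x * g_fun M T pp pm r | r. g_fun M T pp pm r < \<infinity>}
      else Sup {ereal r + ereal x * h_fun M T pp pm r | r. h_fun M T pp pm r < \<infinity>})"

end

theory Submission
  imports Defs
begin

text \<open>
  Put \<open>u = exp (\<lambda> + F\<^sup>+)\<close>. Then \<open>\<Lambda>(\<lambda>) \<le> - r\<close> is witnessed by a positive \<open>u\<close> with
  \<open>\<bbbE>[log u] = \<lambda>\<close> and \<open>p\<^sup>+ u + p\<^sup>- / u \<circ> T\<^sup>-\<^sup>1 \<le> exp (- r)\<close>. The first step decomposition
  of \<open>\<tau>\<^sub>1\<close> shows that \<open>u = 1 / G(\<cdot>, r)\<close> is such a function, with \<open>\<lambda> = - g(r)\<close>. Conversely,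
  optional stopping at \<open>\<tau>\<^sub>1\<close> for the supermartingale attached to any such \<open>u\<close> gives
  \<open>G(\<cdot>, r) \<le> 1 / u\<close>, hence \<open>g(r) \<le> - \<lambda>\<close>. For \<open>x \<ge> 0\<close> these two facts are the two inequalities
  between \<open>I(x)\<close> and \<open>J(x)\<close>; the case \<open>x < 0\<close> follows by reflecting the walk, which exchanges
  \<open>T\<close> with its inverse and \<open>p\<^sup>+\<close> with \<open>p\<^sup>-\<close>.
\<close>

section \<open>First passage probabilities of a nearest neighbour walk\<close>

text \<open>The weight of a first visit to \<open>y\<close> at time \<open>n\<close> by a walk
  started at \<open>x\<close>, with right-step weights \<open>P\<close> and left-step weights
  \<open>Q\<close>. Decomposing at the first step moves the start and keeps the environment
  fixed.\<close>

fun fpp :: "(int \<Rightarrow> real) \<Rightarrow> (int \<Rightarrow> real) \<Rightarrow> int \<Rightarrow> nat \<Rightarrow> int \<Rightarrow> real" where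
  "fpp P Q y 0 x = (if x = y then 1 else 0)"
| "fpp P Q y (Suc n) x =
     (if x = y then 0 else P x * fpp P Q y n (x + 1) + Q x * fpp P Q y n (x - 1))"

lemma fpp_nonneg:
  assumes "\<And>k. 0 \<le> P k" "\<And>k. 0 \<le> Q k"
  shows "0 \<le> fpp P Q y n x"
  using assms by (induction n arbitrary: x) auto

lemma fpp_self: "fpp P Q y n y = (if n = 0 then 1 else 0)"
  by (cases n) auto

text \<open>Used to read a passage from 0 to 1 in the environment seen one site to the left as a
  passage from -1 to 0.\<close>

lemma fpp_shift:
  "fpp (\<lambda>k. P (k + c)) (\<lambda>k. Q (k + c)) y n x = fpp P Q (y + c) n (x + c)"
  by (induction n arbitrary: x) (auto simp: algebra_simps)

text \<open>This mirror symmetry is what reduces passage to -1 to passage to 1.\<close>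

lemma fpp_reflect:
  "fpp (\<lambda>k. Q (- k)) (\<lambda>k. P (- k)) (- y) n (- x) = fpp P Q y n x"
proof (induction n arbitrary: x)
  case (Suc n)
  have "- (x - 1) = - x + 1" "- (x + 1) = - x - 1" by simp_all
  with Suc[of "x + 1"] Suc[of "x - 1"] show ?case
    by (auto simp only: fpp.simps neg_equal_iff_equal minus_minus split: if_split)
qed auto

text \<open>The strong Markov property at the passage through \<open>y\<close>.\<close>
lemma fpp_convolution:
  assumes "x \<le> y" "y \<le> z"
  shows "fpp P Q z n x = (\<Sum>k\<le>n. fpp P Q y k x * fpp P Q z (n - k) y)"
  using assms(1)
proof (induction n arbitrary: x)
  case 0
  then show ?case using assms(2) by auto
next
  case (Suc n)
  show ?case
  proof (cases "x = y")
    case True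
    \<comment> \<open>From \<open>y\<close> itself the passage to \<open>y\<close> takes time 0, so
      only \<open>k = 0\<close> contributes.\<close>
    have "(\<Sum>k\<le>Suc n. fpp P Q y k y * fpp P Q z (Suc n - k) y)
        = (\<Sum>k\<le>Suc n. if k = 0 then fpp P Q z (Suc n) y else 0)"
      by (rule sum.cong) (auto simp: fpp_self)
    also have "\<dots> = fpp P Q z (Suc n) y" by (subst sum.delta) auto
    finally show ?thesis using True by simp
  next
    case False
    \<comment> \<open>Both neighbours of \<open>x\<close> are then still at most \<open>y\<close>,
      so the induction hypothesis covers each of them.\<close>
    with Suc.prems have "x < y" by simp
    have "(\<Sum>k\<le>Suc n. fpp P Q y k x * fpp P Q z (Suc n - k) y)
        = (\<Sum>k\<le>n. fpp P Q y (Suc k) x * fpp P Q z (n - k) y)"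
      using \<open>x < y\<close> by (subst sum.atMost_Suc_shift) simp
    also have "\<dots> = P x * (\<Sum>k\<le>n. fpp P Q y k (x + 1) * fpp P Q z (n - k) y)
                 + Q x * (\<Sum>k\<le>n. fpp P Q y k (x - 1) * fpp P Q z (n - k) y)"
      using \<open>x < y\<close> by (simp add: sum_distrib_left sum.distrib[symmetric] algebra_simps)
    also have "\<dots> = P x * fpp P Q z n (x + 1) + Q x * fpp P Q z n (x - 1)"
      using Suc.IH[of "x + 1"] Suc.IH[of "x - 1"] \<open>x < y\<close> by simp
    finally show ?thesis using \<open>x < y\<close> assms(2) by simp
  qed
qed

section \<open>First passage probabilities as sums over paths\<close>

lemma walk_pos_0: "walk_pos s 0 = 0"
  by (simp add: walk_pos_def)

lemma walk_pos_Cons: "walk_pos (c # s) (Suc k) = (if c then 1 else - 1) + walk_pos s k"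
  unfolding walk_pos_def by (subst sum.lessThan_Suc_shift) simp

text \<open>Allowing an arbitrary start \<open>x\<close> makes the index set of
  \<open>hit_prob\<close> recursive in \<open>n\<close>.\<close>

definition fp_paths :: "int \<Rightarrow> nat \<Rightarrow> int \<Rightarrow> bool list set" where
  "fp_paths y n x = {s. length s = n \<and> x + walk_pos s n = y \<and> (\<forall>k<n. x + walk_pos s k \<noteq> y)}"

lemma finite_fp_paths: "finite (fp_paths y n x)"
  by (rule finite_subset[OF _ finite_lists_length_eq[of "UNIV :: bool set" n]])
     (auto simp: fp_paths_def)

lemma Cons_in_fp_paths:
  "c # s \<in> fp_paths y (Suc n) x \<longleftrightarrow> x \<noteq> y \<and> s \<in> fp_paths y n (x + (if c then 1 else - 1))"
  unfolding fp_paths_def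
  by (auto simp: walk_pos_Cons walk_pos_0 All_less_Suc2 algebra_simps)

lemma fp_paths_Suc:
  "fp_paths y (Suc n) x = (if x = y then {} else
     Cons True ` fp_paths y n (x + 1) \<union> Cons False ` fp_paths y n (x - 1))" (is "?L = ?R")
proof (rule set_eqI)
  fix s
  show "s \<in> ?L \<longleftrightarrow> s \<in> ?R"
  proof (cases s)
    case Nil
    then show ?thesis by (auto simp: fp_paths_def)
  next
    case (Cons c t)
    then show ?thesis by (cases c) (auto simp: Cons_in_fp_paths)
  qed
qed

definition env_weight :: "(int \<Rightarrow> real) \<Rightarrow> (int \<Rightarrow> real) \<Rightarrow> int \<Rightarrow> bool list \<Rightarrow> real" where
  "env_weight P Q x s =
     (\<Prod>k<length s. if s ! k then P (x + walk_pos s k) else Q (x + walk_pos s k))"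

lemma env_weight_Cons:
  "env_weight P Q x (c # s) =
     (if c then P x else Q x) * env_weight P Q (x + (if c then 1 else - 1)) s"
  unfolding env_weight_def
  by (simp only: length_Cons prod.lessThan_Suc_shift)
     (simp add: walk_pos_Cons walk_pos_0 add.assoc cong: if_cong)

text \<open>Splitting the paths by their first letter reproduces the recursion of
  \<open>fpp\<close>.\<close>

lemma sum_env_weight: "(\<Sum>s\<in>fp_paths y n x. env_weight P Q x s) = fpp P Q y n x"
proof (induction n arbitrary: x)
  case 0
  have "fp_paths y 0 x = (if x = y then {[]} else {})"
    by (auto simp: fp_paths_def walk_pos_0)
  then show ?case by (simp add: env_weight_def)
next
  case (Suc n)
  have "(\<Sum>s\<in>fp_paths y (Suc n) x. env_weight P Q x s)
      = (\<Sum>s\<in>Cons True ` fp_paths y n (x + 1). env_weight P Q x s)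
      + (\<Sum>s\<in>Cons False ` fp_paths y n (x - 1). env_weight P Q x s)" if "x \<noteq> y"
    using that finite_fp_paths unfolding fp_paths_Suc
    by (simp, subst sum.union_disjoint) auto
  then show ?case
    using Suc[of "x + 1"] Suc[of "x - 1"]
    by (auto simp: fp_paths_Suc sum.reindex env_weight_Cons sum_distrib_left[symmetric])
qed

lemma hit_prob_eq_fpp:
  "hit_prob M T pp pm y \<omega> n =
     fpp (\<lambda>k. pp (Tpow M T k \<omega>)) (\<lambda>k. pm (Tpow M T k \<omega>)) y n 0"
proof -
  have "hit_prob M T pp pm y \<omega> n = (\<Sum>s\<in>fp_paths y n 0.
      env_weight (\<lambda>k. pp (Tpow M T k \<omega>)) (\<lambda>k. pm (Tpow M T k \<omega>)) 0 s)"
    unfolding hit_prob_def path_prob_def env_weight_def fp_paths_def by (simp cong: if_cong)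
  then show ?thesis by (simp add: sum_env_weight)
qed

text \<open>Along a positive supersolution \<open>h\<close> with \<open>h (k + 1) = U k * h k\<close>, the process
  \<open>exp (r * n) * h (X\<^sub>n)\<close> is a supermartingale.\<close>
lemma fpp_sum_le_supersolution:
  assumes nn: "\<And>k. 0 \<le> P k" "\<And>k. 0 \<le> Q k" and U: "\<And>k. 0 < U k"
    and super: "\<And>k. P k * U k + Q k / U (k - 1) \<le> exp (- r)"
    and "x \<le> 1"
  shows "(\<Sum>n<N. exp (r * real n) * fpp P Q 1 n x) \<le> (\<Prod>k\<in>{x..0}. 1 / U k)"
  using \<open>x \<le> 1\<close>
\<comment> \<open>Induction on the truncation \<open>N\<close> replaces optional stopping by a
  finite computation in which no convergence has to be checked.\<close>
proof (induction N arbitrary: x)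
  case 0
  show ?case using U by (auto intro!: prod_nonneg simp: less_imp_le)
next
  case (Suc N)
  \<comment> \<open>The normalisation is \<open>h 1 = 1\<close>, an empty product. The ratio rule is
    needed only at sites up to 0, those visited before reaching 1.\<close>
  define h where "h x = (\<Prod>k\<in>{x..0::int}. 1 / U k)" for x
  define A where "A x = (\<Sum>n<N. exp (r * real n) * fpp P Q 1 n x)" for x
  have h_pos: "0 < h x" for x unfolding h_def using U by (auto intro!: prod_pos)
  have h_rec: "h x = h (x + 1) / U x" if "x \<le> 0" for x
  proof -
    have "{x..0} = insert x {x + 1..0}" using that by auto
    then show ?thesis by (simp add: h_def)
  qed
  have "(\<Sum>n<Suc N. exp (r * real n) * fpp P Q 1 n x) \<le> h x"
  proof (cases "x = 1")
    case True
    have "(\<Sum>n<Suc N. exp (r * real n) * fpp P Q 1 n x) = 1"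
      using True by (subst sum.lessThan_Suc_shift) (simp add: fpp_self)
    then show ?thesis using True by (simp add: h_def)
  next
    case False
    with Suc.prems have "x \<le> 0" by simp
    have "(\<Sum>n<Suc N. exp (r * real n) * fpp P Q 1 n x)
        = (\<Sum>n<N. exp (r * real (Suc n)) * fpp P Q 1 (Suc n) x)"
      using False by (subst sum.lessThan_Suc_shift) simp
    also have "\<dots> = exp r * (P x * A (x + 1) + Q x * A (x - 1))"
      using False
      by (simp add: A_def sum_distrib_left sum.distrib[symmetric] algebra_simps exp_add)
    also have "\<dots> \<le> exp r * (P x * h (x + 1) + Q x * h (x - 1))"
      using nn Suc.IH[of "x + 1"] Suc.IH[of "x - 1"] \<open>x \<le> 0\<close>
      by (auto simp: A_def h_def intro!: mult_left_mono add_mono)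
    also have "P x * h (x + 1) + Q x * h (x - 1) = h x * (P x * U x + Q x / U (x - 1))"
      using h_rec[of x] h_rec[of "x - 1"] U[of x] U[of "x - 1"] \<open>x \<le> 0\<close>
      by (simp add: field_simps)
    also have "exp r * \<dots> \<le> exp r * (h x * exp (- r))"
      using super[of x] h_pos[of x] by (intro mult_left_mono) auto
    also have "\<dots> = h x" by (simp add: exp_minus)
    finally show ?thesis .
  qed
  then show ?case by (simp add: h_def)
qed

text \<open>To pass from \<open>-1\<close> to \<open>1\<close> the walk passes \<open>0\<close> first, so a step to the left
  contributes a product of two generating functions.\<close>
lemma fpp_gf_recursion:
  fixes P Q :: "int \<Rightarrow> real" and r :: real
  defines "f \<equiv> \<lambda>y x n. exp (r * real n) * fpp P Q y n x"
  assumes nn: "\<And>k. 0 \<le> P k" "\<And>k. 0 \<le> Q k"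
    and S1: "summable (f 1 0)" and S0: "summable (f 0 (- 1))"
  shows "(\<Sum>n. f 1 0 n) = exp r * (P 0 + Q 0 * ((\<Sum>n. f 0 (- 1) n) * (\<Sum>n. f 1 0 n)))"
proof -
  have f_nn: "0 \<le> f y x n" for y x n
    unfolding f_def by (simp add: fpp_nonneg nn)
  \<comment> \<open>The weight \<open>exp (r * n)\<close> factors over the two passages, so the
    strong Markov property becomes a Cauchy product.\<close>
  have conv: "f 1 (- 1) n = (\<Sum>k\<le>n. f 0 (- 1) k * f 1 0 (n - k))" for n
  proof -
    have "f 1 (- 1) n
        = (\<Sum>k\<le>n. exp (r * real n) * (fpp P Q 0 k (- 1) * fpp P Q 1 (n - k) 0))"
      unfolding f_def by (subst fpp_convolution[where y = 0]) (auto simp: sum_distrib_left)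
    also have "\<dots> = (\<Sum>k\<le>n. f 0 (- 1) k * f 1 0 (n - k))"
    proof (rule sum.cong, simp)
      fix k assume "k \<in> {..n}"
      then have "real n = real k + real (n - k)" by simp
      then have "exp (r * real n) = exp (r * real k) * exp (r * real (n - k))"
        by (simp only: distrib_left exp_add)
      then show "exp (r * real n) * (fpp P Q 0 k (- 1) * fpp P Q 1 (n - k) 0)
          = f 0 (- 1) k * f 1 0 (n - k)"
        by (simp add: f_def)
    qed
    finally show ?thesis .
  qed
  have nS0: "summable (\<lambda>k. norm (f 0 (- 1) k))" and nS1: "summable (\<lambda>k. norm (f 1 0 k))"
    using S0 S1 f_nn by simp_all
  have prod: "f 1 (- 1) sums ((\<Sum>n. f 0 (- 1) n) * (\<Sum>n. f 1 0 n))"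
    using Cauchy_product_sums[OF nS0 nS1] by (simp only: conv[symmetric])
  have one: "f 1 1 sums 1"
    using sums_single[of 0 "\<lambda>_. 1 :: real"] by (simp add: f_def fpp_self if_distrib cong: if_cong)
  have step: "f 1 0 (Suc n) = exp r * (P 0 * f 1 1 n + Q 0 * f 1 (- 1) n)" for n
    by (simp add: f_def algebra_simps exp_add)
  have "(\<lambda>n. f 1 0 (Suc n)) sums
      (exp r * (P 0 * 1 + Q 0 * ((\<Sum>n. f 0 (- 1) n) * (\<Sum>n. f 1 0 n))))"
    unfolding step by (intro sums_mult sums_add one prod)
  moreover have "f 1 0 0 = 0" by (simp add: f_def)
  ultimately have "f 1 0 sums
      (exp r * (P 0 * 1 + Q 0 * ((\<Sum>n. f 0 (- 1) n) * (\<Sum>n. f 1 0 n))))"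
    using sums_Suc[of "f 1 0"] by fastforce
  then show ?thesis by (simp add: sums_iff)
qed

section \<open>Extended expectations of logarithms\<close>

lemma e2ennreal_max_ereal: "e2ennreal (max (ereal t) 0) = ennreal t"
  by (cases "0 \<le> t") (auto simp: max_def ennreal_neg zero_ereal_def[symmetric])

text \<open>Integrability makes both truncated integrals finite, so the difference in
  \<open>eexpect\<close> is one of real numbers.\<close>

lemma eexpect_eq_integral:
  assumes "integrable M f" "AE \<omega> in M. X \<omega> = ereal (f \<omega>)"
  shows "eexpect M X = ereal (integral\<^sup>L M f)"
proof -
  have 1: "(\<integral>\<^sup>+\<omega>. e2ennreal (max (X \<omega>) 0) \<partial>M) = (\<integral>\<^sup>+\<omega>. ennreal (f \<omega>) \<partial>M)"
    using assms(2) by (intro nn_integral_cong_AE) (auto simp: e2ennreal_max_ereal)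
  have 2: "(\<integral>\<^sup>+\<omega>. e2ennreal (max (- X \<omega>) 0) \<partial>M) = (\<integral>\<^sup>+\<omega>. ennreal (- f \<omega>) \<partial>M)"
    using assms(2) by (intro nn_integral_cong_AE) (auto simp: e2ennreal_max_ereal)
  have fin: "(\<integral>\<^sup>+\<omega>. ennreal (f \<omega>) \<partial>M) < \<infinity>" "(\<integral>\<^sup>+\<omega>. ennreal (- f \<omega>) \<partial>M) < \<infinity>"
    using assms(1) by (auto simp: real_integrable_def less_top)
  then obtain p q where pq: "(\<integral>\<^sup>+\<omega>. ennreal (f \<omega>) \<partial>M) = ennreal p" "0 \<le> p"
      "(\<integral>\<^sup>+\<omega>. ennreal (- f \<omega>) \<partial>M) = ennreal q" "0 \<le> q"
    by (metis enn2real_nonneg ennreal_enn2real infinity_ennreal_def)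
  then show ?thesis
    unfolding eexpect_def 1 2 real_lebesgue_integral_def[OF assms(1)] by simp
qed

text \<open>The lower bound makes the negative part of \<open>elog G\<close> bounded, and an
  expectation below infinity makes the positive part integrable.\<close>

lemma eexpect_elog_finite:
  assumes "prob_space M" and [measurable]: "G \<in> borel_measurable M"
    and "0 < c" and lower: "AE \<omega> in M. ennreal c \<le> G \<omega>"
    and fin: "eexpect M (\<lambda>\<omega>. elog (G \<omega>)) < \<infinity>"
  shows "AE \<omega> in M. G \<omega> < \<infinity>" and "integrable M (\<lambda>\<omega>. ln (enn2real (G \<omega>)))"
proof -
  interpret prob_space M by fact
  have [measurable]: "(\<lambda>\<omega>. elog (G \<omega>)) \<in> borel_measurable M"
    unfolding elog_def by measurable
  have neg: "- elog z \<le> ereal (\<bar>ln c\<bar>)" if "ennreal c \<le> z" for z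
  proof (cases "z = \<infinity>")
    case False
    then obtain t where "z = ennreal t" "0 \<le> t" by (cases z) auto
    with that \<open>0 < c\<close> have "c \<le> t" by (simp add: ennreal_le_iff2)
    with \<open>0 < c\<close> have "ln c \<le> ln t" by simp
    then have "- ln t \<le> \<bar>ln c\<bar>" by linarith
    with \<open>z = ennreal t\<close> \<open>c \<le> t\<close> \<open>0 < c\<close> show ?thesis by (simp add: elog_def)
  qed (simp add: elog_def)
  have "(\<integral>\<^sup>+\<omega>. e2ennreal (max (- elog (G \<omega>)) 0) \<partial>M) \<le> (\<integral>\<^sup>+\<omega>. ennreal \<bar>ln c\<bar> \<partial>M)"
  proof (rule nn_integral_mono_AE)
    show "AE \<omega> in M. e2ennreal (max (- elog (G \<omega>)) 0) \<le> ennreal \<bar>ln c\<bar>"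
      using lower
    proof eventually_elim
      case (elim \<omega>)
      then have "max (- elog (G \<omega>)) 0 \<le> max (ereal \<bar>ln c\<bar>) 0"
        by (intro max.mono neg order_refl)
      then show ?case using e2ennreal_mono e2ennreal_max_ereal by metis
    qed
  qed
  also have "\<dots> < \<infinity>" by (simp add: emeasure_space_1)
  finally have n: "(\<integral>\<^sup>+\<omega>. e2ennreal (max (- elog (G \<omega>)) 0) \<partial>M) < \<infinity>" .
  have p: "(\<integral>\<^sup>+\<omega>. e2ennreal (max (elog (G \<omega>)) 0) \<partial>M) < \<infinity>"
  proof (rule ccontr)
    assume "\<not> ?thesis"
    then have "(\<integral>\<^sup>+\<omega>. e2ennreal (max (elog (G \<omega>)) 0) \<partial>M) = \<infinity>"
      by (simp add: less_top[symmetric])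
    \<comment> \<open>In \<open>ereal\<close>, infinity minus anything is infinity.\<close>
    then have "eexpect M (\<lambda>\<omega>. elog (G \<omega>)) = \<infinity>"
      unfolding eexpect_def by simp
    with fin show False by simp
  qed
  have "AE \<omega> in M. e2ennreal (max (elog (G \<omega>)) 0) \<noteq> \<infinity>"
    using p by (intro nn_integral_PInf_AE) auto
  then show f: "AE \<omega> in M. G \<omega> < \<infinity>"
  proof eventually_elim
    case (elim \<omega>)
    then have "G \<omega> \<noteq> \<infinity>" by (auto simp: elog_def)
    then show ?case by (simp add: less_top)
  qed
  have G: "AE \<omega> in M. elog (G \<omega>) = ereal (ln (enn2real (G \<omega>)))"
    using f lower by eventually_elim (use \<open>0 < c\<close> in \<open>auto simp: elog_def\<close>)
  have "(\<integral>\<^sup>+\<omega>. ennreal (ln (enn2real (G \<omega>))) \<partial>M) = (\<integral>\<^sup>+\<omega>. e2ennreal (max (elog (G \<omega>)) 0) \<partial>M)"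
    using G by (intro nn_integral_cong_AE) (auto simp: e2ennreal_max_ereal)
  moreover have "(\<integral>\<^sup>+\<omega>. ennreal (- ln (enn2real (G \<omega>))) \<partial>M)
      = (\<integral>\<^sup>+\<omega>. e2ennreal (max (- elog (G \<omega>)) 0) \<partial>M)"
    using G by (intro nn_integral_cong_AE) (auto simp: e2ennreal_max_ereal)
  ultimately show "integrable M (\<lambda>\<omega>. ln (enn2real (G \<omega>)))"
    using n p by (simp add: real_integrable_def less_top)
qed

section \<open>Invertible measure preserving maps\<close>

lemma invertible_mpD:
  assumes "invertible_mp M T"
  defines "S \<equiv> the_inv_into (space M) T"
  shows "T \<in> M \<rightarrow>\<^sub>M M" "S \<in> M \<rightarrow>\<^sub>M M" "distr M M T = M" "distr M M S = M"
    and "\<And>\<omega>. \<omega> \<in> space M \<Longrightarrow> S (T \<omega>) = \<omega>" "\<And>\<omega>. \<omega> \<in> space M \<Longrightarrow> T (S \<omega>) = \<omega>"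
    and "\<And>\<omega>. \<omega> \<in> space M \<Longrightarrow> the_inv_into (space M) S \<omega> = T \<omega>"
    and "bij_betw S (space M) (space M)"
proof -
  have bij: "bij_betw T (space M) (space M)"
    using assms by (simp add: invertible_mp_def)
  show [measurable]: "T \<in> M \<rightarrow>\<^sub>M M" "S \<in> M \<rightarrow>\<^sub>M M" and T: "distr M M T = M"
    using assms by (auto simp: invertible_mp_def)
  show ST: "S (T \<omega>) = \<omega>" if "\<omega> \<in> space M" for \<omega>
    using bij that unfolding S_def bij_betw_def by (simp add: the_inv_into_f_f)
  show TS: "T (S \<omega>) = \<omega>" if "\<omega> \<in> space M" for \<omega>
    using bij that unfolding S_def by (simp add: f_the_inv_into_f_bij_betw)
  show bijS: "bij_betw S (space M) (space M)"
    using bij unfolding S_def by (rule bij_betw_the_inv_into)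
  show "the_inv_into (space M) S \<omega> = T \<omega>" if "\<omega> \<in> space M" for \<omega>
    using bijS that ST[OF that] measurable_space[OF \<open>T \<in> M \<rightarrow>\<^sub>M M\<close> that]
    unfolding bij_betw_def by (intro the_inv_into_f_eq) auto
  \<comment> \<open>Writing \<open>M\<close> as its own image under \<open>T\<close> turns the image
    under \<open>S\<close> into the image under \<open>S \<circ> T\<close>, the identity on
    \<open>space M\<close>.\<close>
  have "distr M M S = distr (distr M M T) M S" by (simp only: T)
  also have "\<dots> = distr M M (S \<circ> T)" by (rule distr_distr) measurable
  also have "\<dots> = distr M M (\<lambda>\<omega>. \<omega>)" by (rule distr_cong) (auto simp: ST)
  finally show "distr M M S = M" by (simp add: distr_id)
qed

lemma invertible_mp_inverse:
  assumes "invertible_mp M T"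
  shows "invertible_mp M (the_inv_into (space M) T)"
proof -
  note D = invertible_mpD[OF assms]
  \<comment> \<open>The double inverse is known to equal \<open>T\<close> only on
    \<open>space M\<close>, which suffices for measurability.\<close>
  have "the_inv_into (space M) (the_inv_into (space M) T) \<in> M \<rightarrow>\<^sub>M M"
    using D(1) measurable_cong[of M "the_inv_into (space M) (the_inv_into (space M) T)" T M] D(7)
    by simp
  then show ?thesis using D by (simp add: invertible_mp_def)
qed

lemma AE_comp_preserving:
  assumes "f \<in> M \<rightarrow>\<^sub>M M" "distr M M f = M" "AE \<omega> in M. P \<omega>"
  shows "AE \<omega> in M. P (f \<omega>)"
  by (rule AE_distrD[OF assms(1), of P, unfolded assms(2), OF assms(3)])

lemma funpow_preserving:
  assumes "f \<in> M \<rightarrow>\<^sub>M M" "distr M M f = M"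
  shows "f ^^ n \<in> M \<rightarrow>\<^sub>M M" and "distr M M (f ^^ n) = M"
proof -
  show *: "f ^^ n \<in> M \<rightarrow>\<^sub>M M" for n
    by (induction n) (use assms(1) in \<open>auto simp: measurable_comp\<close>)
  show "distr M M (f ^^ n) = M"
  proof (induction n)
    case 0
    then show ?case by (simp add: id_def distr_id)
  next
    case (Suc n)
    have "distr M M (f ^^ Suc n) = distr (distr M M (f ^^ n)) M f"
      by (simp add: distr_distr[OF assms(1) *] o_def)
    then show ?case by (simp only: Suc assms(2))
  qed
qed

lemma Tpow_preserving:
  assumes "invertible_mp M T"
  shows "Tpow M T k \<in> M \<rightarrow>\<^sub>M M" and "distr M M (Tpow M T k) = M"
  using invertible_mpD(1-4)[OF assms] by (simp_all add: Tpow_def funpow_preserving)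

text \<open>There are countably many integers, so one null set serves the whole two-sided
  orbit.\<close>

lemma AE_Tpow:
  assumes "invertible_mp M T" "AE \<omega> in M. P \<omega>"
  shows "AE \<omega> in M. \<forall>k. P (Tpow M T k \<omega>)"
  unfolding AE_all_countable
  using AE_comp_preserving[OF Tpow_preserving[OF assms(1)] assms(2)] by blast

text \<open>The case split follows the definition of \<open>Tpow\<close>: for positive
  \<open>k\<close> one factor \<open>T\<close> cancels, otherwise one more inverse is
  applied.\<close>

lemma Tpow_inv_apply:
  assumes "invertible_mp M T" "\<omega> \<in> space M"
  shows "Tpow M T k (the_inv_into (space M) T \<omega>) = Tpow M T (k - 1) \<omega>"
proof (cases "0 < k")
  case True
  then obtain n where n: "nat k = Suc n" "nat (k - 1) = n"
    by (metis Suc_nat_eq_nat_zadd1 diff_add_cancel zle_diff1_eq add.commute)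
  have "(T ^^ Suc n) (the_inv_into (space M) T \<omega>) = (T ^^ n) \<omega>"
    using invertible_mpD(6)[OF assms] by (simp add: funpow_swap1)
  with True n show ?thesis by (simp add: Tpow_def)
next
  case False
  then have "nat (- (k - 1)) = Suc (nat (- k))" by simp
  with False show ?thesis
    by (auto simp: Tpow_def funpow_swap1 simp del: minus_diff_eq)
qed

lemma inv_apply_Tpow:
  assumes "invertible_mp M T" "\<omega> \<in> space M"
  shows "the_inv_into (space M) T (Tpow M T k \<omega>) = Tpow M T (k - 1) \<omega>"
proof (cases "0 < k")
  case True
  then obtain n where n: "nat k = Suc n" "nat (k - 1) = n"
    by (metis Suc_nat_eq_nat_zadd1 diff_add_cancel zle_diff1_eq add.commute)
  have "(T ^^ n) \<omega> \<in> space M"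
    using funpow_preserving(1)[OF invertible_mpD(1,3)[OF assms(1)]] assms(2)
    by (rule measurable_space)
  with True n show ?thesis
    by (simp add: Tpow_def invertible_mpD(5)[OF assms(1)])
next
  case False
  then have "nat (- (k - 1)) = Suc (nat (- k))" by simp
  with False show ?thesis by (auto simp: Tpow_def simp del: minus_diff_eq)
qed

lemma Tpow_inv:
  assumes "invertible_mp M T" "\<omega> \<in> space M"
  shows "Tpow M (the_inv_into (space M) T) k \<omega> = Tpow M T (- k) \<omega>"
proof -
  let ?S = "the_inv_into (space M) T"
  have T: "(T ^^ n) \<omega> \<in> space M" for n
    using funpow_preserving(1)[OF invertible_mpD(1,3)[OF assms(1)]] assms(2)
    by (rule measurable_space)
  have "(the_inv_into (space M) ?S ^^ n) \<omega> = (T ^^ n) \<omega>" for n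
    by (induction n) (use T invertible_mpD(7)[OF assms(1)] in auto)
  then show ?thesis by (auto simp: Tpow_def)
qed

section \<open>The rate functions\<close>

text \<open>These assumptions hold both for the given environment and for its mirror image, with
  \<open>T\<close> replaced by its inverse and \<open>pp\<close>, \<open>pm\<close>
  exchanged.\<close>

locale random_environment = prob_space M for M :: "'w measure" +
  fixes T :: "'w \<Rightarrow> 'w" and pp pm :: "'w \<Rightarrow> real" and a :: real
  assumes inv: "invertible_mp M T"
    and pp_measurable [measurable]: "pp \<in> borel_measurable M"
    and pm_measurable [measurable]: "pm \<in> borel_measurable M"
    and pp_nonneg: "\<And>\<omega>. \<omega> \<in> space M \<Longrightarrow> 0 \<le> pp \<omega>"
    and pm_nonneg: "\<And>\<omega>. \<omega> \<in> space M \<Longrightarrow> 0 \<le> pm \<omega>"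
    and a_pos: "0 < a"
    and a_le_pp: "AE \<omega> in M. a \<le> pp \<omega>"
begin

abbreviation (input) "S \<equiv> the_inv_into (space M) T"

abbreviation (input) "G r \<omega> \<equiv> hit_mgf M T pp pm 1 \<omega> r"

abbreviation (input) "right_env \<omega> k \<equiv> pp (Tpow M T k \<omega>)"

abbreviation (input) "left_env \<omega> k \<equiv> pm (Tpow M T k \<omega>)"

section \<open>The generating function of the passage time to 1\<close>

lemma T_measurable [measurable]: "T \<in> M \<rightarrow>\<^sub>M M"
  and S_measurable [measurable]: "S \<in> M \<rightarrow>\<^sub>M M"
  and Tpow_measurable [measurable]: "Tpow M T k \<in> M \<rightarrow>\<^sub>M M"
  using invertible_mpD[OF inv] Tpow_preserving[OF inv] by auto

lemma env_nonneg:
  assumes "\<omega> \<in> space M"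
  shows "0 \<le> right_env \<omega> k" "0 \<le> left_env \<omega> k"
  using measurable_space[OF Tpow_measurable assms] pp_nonneg pm_nonneg by auto

lemma hit_mgf_eq:
  "G r \<omega> = (\<Sum>n. ennreal (exp (r * real n) * fpp (right_env \<omega>) (left_env \<omega>) 1 n 0))"
  by (simp add: hit_mgf_def hit_prob_eq_fpp)

lemma hit_mgf_measurable [measurable]: "G r \<in> borel_measurable M"
proof -
  have [measurable]: "(\<lambda>\<omega>. fpp (right_env \<omega>) (left_env \<omega>) y n x) \<in> borel_measurable M" for y n x
    by (induction n arbitrary: x) auto
  show ?thesis unfolding hit_mgf_eq by measurable
qed

text \<open>One step to the right already reaches 1, so the term \<open>n = 1\<close> alone gives
  the bound.\<close>

lemma hit_mgf_ge:
  assumes "\<omega> \<in> space M" "a \<le> pp \<omega>"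
  shows "ennreal (a * exp r) \<le> G r \<omega>"
proof -
  let ?f = "\<lambda>n. ennreal (exp (r * real n) * fpp (right_env \<omega>) (left_env \<omega>) 1 n 0)"
  have "ennreal (a * exp r) \<le> ?f 1"
    using assms by (intro ennreal_leI) (simp add: Tpow_def)
  also have "\<dots> \<le> (\<Sum>n<2. ?f n)"
    by (simp add: numeral_2_eq_2)
  also have "\<dots> \<le> suminf ?f" by (intro sum_le_suminf) auto
  finally show ?thesis by (simp add: hit_mgf_eq)
qed

lemma hit_mgf_eq_suminf:
  fixes r
  defines "f \<equiv> \<lambda>\<omega> n. exp (r * real n) * fpp (right_env \<omega>) (left_env \<omega>) 1 n 0"
  assumes "\<omega> \<in> space M" "G r \<omega> < \<infinity>"
  shows "summable (f \<omega>)" and "enn2real (G r \<omega>) = suminf (f \<omega>)"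
proof -
  have nn: "0 \<le> f \<omega> n" for n
    unfolding f_def using env_nonneg[OF assms(2)] by (simp add: fpp_nonneg)
  have G: "G r \<omega> = (\<Sum>n. ennreal (f \<omega> n))" by (simp add: hit_mgf_eq f_def)
  show *: "summable (f \<omega>)"
    using assms(3) nn by (intro summable_suminf_not_top) (auto simp: G)
  show "enn2real (G r \<omega>) = suminf (f \<omega>)"
    using nn * by (simp add: G suminf_ennreal2 suminf_nonneg)
qed

text \<open>The reciprocal \<open>u = 1 / G\<close> solves \<open>p\<^sup>+ u + p\<^sup>- / u \<circ> T\<^sup>-\<^sup>1 = exp (- r)\<close>.\<close>
lemma hit_mgf_recursion:
  assumes w: "\<omega> \<in> space M" and fin: "G r \<omega> < \<infinity>" "G r (S \<omega>) < \<infinity>" and pos: "0 < G r \<omega>"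
  shows "pp \<omega> / enn2real (G r \<omega>) + pm \<omega> * enn2real (G r (S \<omega>)) = exp (- r)"
proof -
  let ?P = "right_env \<omega>" and ?Q = "left_env \<omega>"
  have Sw: "S \<omega> \<in> space M" using w by (rule measurable_space[OF S_measurable])
  \<comment> \<open>Seen from \<open>S \<omega>\<close> the environment is moved by one site, so
    \<open>G r (S \<omega>)\<close> describes the passage from -1 to 0 in the environment
    \<open>\<omega>\<close>.\<close>
  have "fpp (right_env (S \<omega>)) (left_env (S \<omega>)) 1 n 0 = fpp ?P ?Q 0 n (- 1)" for n
    using fpp_shift[of ?P "- 1" ?Q 1 n 0] by (simp add: Tpow_inv_apply[OF inv w])
  then have S0: "summable (\<lambda>n. exp (r * real n) * fpp ?P ?Q 0 n (- 1))"
    and GS: "enn2real (G r (S \<omega>)) = (\<Sum>n. exp (r * real n) * fpp ?P ?Q 0 n (- 1))"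
    using hit_mgf_eq_suminf[OF Sw fin(2)] by simp_all
  have "enn2real (G r \<omega>)
      = exp r * (pp \<omega> + pm \<omega> * (enn2real (G r (S \<omega>)) * enn2real (G r \<omega>)))"
    using fpp_gf_recursion[OF env_nonneg[OF w] hit_mgf_eq_suminf(1)[OF w fin(1)] S0]
    unfolding GS hit_mgf_eq_suminf(2)[OF w fin(1)] by (simp add: Tpow_def)
  moreover have "0 < enn2real (G r \<omega>)" using fin pos by (simp add: enn2real_positive_iff)
  ultimately show ?thesis by (simp add: exp_minus field_simps)
qed

text \<open>The truncated bound passes to the limit; at start 0 its product is the single factor
  \<open>1 / U 0\<close>.\<close>

lemma hit_mgf_le_supersolution:
  assumes w: "\<omega> \<in> space M" and U: "\<And>k. 0 < U k"
    and super: "\<And>k. right_env \<omega> k * U k + left_env \<omega> k / U (k - 1) \<le> exp (- r)"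
  shows "G r \<omega> \<le> ennreal (1 / U 0)"
proof -
  have "(\<Sum>n<N. exp (r * real n) * fpp (right_env \<omega>) (left_env \<omega>) 1 n 0) \<le> 1 / U 0" for N
    using fpp_sum_le_supersolution[of "right_env \<omega>" "left_env \<omega>" U r 0 N]
      env_nonneg[OF w] U super by simp
  then show ?thesis
    unfolding hit_mgf_eq using env_nonneg[OF w]
    by (intro suminf_le_const) (auto simp: sum_ennreal fpp_nonneg intro!: ennreal_leI)
qed

section \<open>Duality between g and Lambda\<close>

lemma integral_preserving:
  fixes f :: "'w \<Rightarrow> real"
  assumes "\<phi> \<in> M \<rightarrow>\<^sub>M M" "distr M M \<phi> = M" and "integrable M f"
  shows "integrable M (\<lambda>\<omega>. f (\<phi> \<omega>))" and "(\<integral>\<omega>. f (\<phi> \<omega>) \<partial>M) = integral\<^sup>L M f"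
  using integrable_distr[of \<phi> M M f] integral_distr[of \<phi> M M f] assms by auto

text \<open>The reciprocal of \<open>G\<close> yields a pair in \<open>class_K\<close> for which the
  function under the essential supremum is almost surely the constant \<open>- r\<close>.\<close>

lemma Lambda_le_of_g_finite:
  assumes "g_fun M T pp pm r < \<infinity>"
  obtains l where "g_fun M T pp pm r = ereal (- l)" "Lambda M T pp pm l \<le> ereal (- r)"
proof
  let ?L = "\<lambda>\<omega>. ln (enn2real (G r \<omega>))"
  define l where "l = - integral\<^sup>L M ?L"
  \<comment> \<open>Centring by \<open>l\<close> gives mean 0 and
    \<open>exp (l + Fp) = 1 / G\<close> wherever \<open>G\<close> is positive and finite;
    \<open>Fm\<close> is then forced by the relation in \<open>class_K\<close>.\<close>
  define Fp where "Fp \<omega> = - ?L \<omega> - l" for \<omega>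
  define Fm where "Fm \<omega> = - Fp (S \<omega>)" for \<omega>
  note D = invertible_mpD[OF inv]
  have c: "0 < a * exp r" using a_pos by simp
  have lower: "AE \<omega> in M. ennreal (a * exp r) \<le> G r \<omega>"
    using a_le_pp AE_space by eventually_elim (rule hit_mgf_ge)
  have fin: "AE \<omega> in M. G r \<omega> < \<infinity>" and int: "integrable M ?L"
    using eexpect_elog_finite[OF prob_space_axioms hit_mgf_measurable c lower] assms
    by (simp_all add: g_fun_def)
  have pos: "AE \<omega> in M. 0 < G r \<omega>"
    using lower by eventually_elim (use c in \<open>auto intro: less_le_trans[rotated]\<close>)
  have "AE \<omega> in M. elog (G r \<omega>) = ereal (?L \<omega>)"
    using fin pos by eventually_elim (auto simp: elog_def)
  from eexpect_eq_integral[OF int this] show "g_fun M T pp pm r = ereal (- l)"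
    by (simp add: g_fun_def l_def)
  have Fp: "integrable M Fp" "integral\<^sup>L M Fp = 0"
    unfolding Fp_def using int by (auto simp: l_def prob_space)
  have Fm: "integrable M Fm" "integral\<^sup>L M Fm = 0"
    unfolding Fm_def using integral_preserving[OF D(2,4) Fp(1)] Fp(2) by auto
  have "AE \<omega> in M. Fp \<omega> + Fm (T \<omega>) = 0"
    using AE_space by eventually_elim (simp add: Fm_def D(5))
  with Fp Fm have K: "(Fp, Fm) \<in> class_K M T" by (simp add: class_K_def)
  have "AE \<omega> in M. ln (pp \<omega> * exp (l + Fp \<omega>) + pm \<omega> * exp (- l + Fm \<omega>)) = - r"
    using fin pos AE_comp_preserving[OF D(2,4) fin] AE_comp_preserving[OF D(2,4) pos] AE_space
  proof eventually_elim
    case (elim \<omega>)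
    then have "0 < enn2real (G r \<omega>)" "0 < enn2real (G r (S \<omega>))"
      by (simp_all add: enn2real_positive_iff)
    then have "exp (l + Fp \<omega>) = 1 / enn2real (G r \<omega>)" "exp (- l + Fm \<omega>) = enn2real (G r (S \<omega>))"
      by (simp_all add: Fp_def Fm_def exp_minus divide_inverse)
    then show ?case using hit_mgf_recursion[of \<omega> r] elim by simp
  qed
  \<comment> \<open>Measurability matters here: \<open>esssup\<close> of a non-measurable function
    is the top element.\<close>
  moreover have "(\<lambda>\<omega>. ereal (ln (pp \<omega> * exp (l + Fp \<omega>) + pm \<omega> * exp (- l + Fm \<omega>)))) \<in> borel_measurable M"
    using borel_measurable_integrable[OF Fp(1)] borel_measurable_integrable[OF Fm(1)] by measurable
  ultimately have "esssup M (\<lambda>\<omega>. ereal (ln (pp \<omega> * exp (l + fst (Fp, Fm) \<omega>)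
                                     + pm \<omega> * exp (- l + snd (Fp, Fm) \<omega>)))) \<le> ereal (- r)"
    by (intro esssup_I) (auto elim: eventually_mono)
  then show "Lambda M T pp pm l \<le> ereal (- r)"
    unfolding Lambda_def using K by (rule INF_lower2[rotated])
qed

text \<open>Here \<open>exp (l + Fp)\<close> is the ratio of a supersolution along almost every
  orbit. Hence \<open>ln G \<le> - l - Fp\<close>, and integration removes \<open>Fp\<close>, which
  has mean 0.\<close>

lemma g_fun_le_of_class_K:
  assumes K: "(Fp, Fm) \<in> class_K M T"
    and bound: "AE \<omega> in M. ln (pp \<omega> * exp (l + Fp \<omega>) + pm \<omega> * exp (- l + Fm \<omega>)) \<le> - r"
  obtains m where "g_fun M T pp pm r = ereal m" "m \<le> - l"
proof
  let ?L = "\<lambda>\<omega>. ln (enn2real (G r \<omega>))"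
  note D = invertible_mpD[OF inv]
  have Fp: "integrable M Fp" "integral\<^sup>L M Fp = 0" and Fm: "AE \<omega> in M. Fp \<omega> + Fm (T \<omega>) = 0"
    using K by (auto simp: class_K_def)
  have good: "AE \<omega> in M. pp \<omega> * exp (l + Fp \<omega>) + pm \<omega> / exp (l + Fp (S \<omega>)) \<le> exp (- r)"
    using AE_comp_preserving[OF D(2,4) Fm] bound a_le_pp AE_space
  proof eventually_elim
    case (elim \<omega>)
    then have "Fm \<omega> = - Fp (S \<omega>)" by (simp add: D(6))
    then have 1: "exp (- l + Fm \<omega>) = 1 / exp (l + Fp (S \<omega>))"
      by (simp add: exp_minus[symmetric] divide_inverse)
    \<comment> \<open>A bound on \<open>ln\<close> can be exponentiated only where its argument is
      positive; \<open>a \<le> pp \<omega>\<close> ensures this.\<close>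
    have "0 < pp \<omega> * exp (l + Fp \<omega>) + pm \<omega> * exp (- l + Fm \<omega>)"
      using elim a_pos pm_nonneg[of \<omega>] by (intro add_pos_nonneg) auto
    then have "pp \<omega> * exp (l + Fp \<omega>) + pm \<omega> * exp (- l + Fm \<omega>) \<le> exp (- r)"
      using elim by (metis exp_le_cancel_iff exp_ln)
    then show ?case unfolding 1 by simp
  qed
  have upper: "AE \<omega> in M. G r \<omega> \<le> ennreal (exp (- l - Fp \<omega>))"
    using AE_Tpow[OF inv good] AE_space
  proof eventually_elim
    case (elim \<omega>)
    have "1 / exp (l + Fp (Tpow M T 0 \<omega>)) = exp (- l - Fp \<omega>)"
      using exp_minus[of "l + Fp \<omega>"] by (simp add: Tpow_def divide_inverse)
    then show ?case
      using hit_mgf_le_supersolution[of \<omega> "\<lambda>k. exp (l + Fp (Tpow M T k \<omega>))" r] elim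
      by (simp add: inv_apply_Tpow[OF inv])
  qed
  have lower: "AE \<omega> in M. ennreal (a * exp r) \<le> G r \<omega>"
    using a_le_pp AE_space by eventually_elim (rule hit_mgf_ge)
  \<comment> \<open>Integrable bounds from both sides make \<open>ln G\<close> integrable, so that
    \<open>g\<close> is a real number.\<close>
  have both: "AE \<omega> in M. elog (G r \<omega>) = ereal (?L \<omega>) \<and> ln (a * exp r) \<le> ?L \<omega> \<and> ?L \<omega> \<le> - l - Fp \<omega>"
    using upper lower
  proof eventually_elim
    case (elim \<omega>)
    then obtain t where t: "G r \<omega> = ennreal t" "0 \<le> t"
      by (cases "G r \<omega>") (auto simp: top_unique)
    with elim a_pos have at: "a * exp r \<le> t" "t \<le> exp (- l - Fp \<omega>)"
      by (auto simp: ennreal_le_iff2)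
    moreover have "0 < a * exp r" using a_pos by simp
    ultimately have "0 < t" by linarith
    have "ln t \<le> ln (exp (- l - Fp \<omega>))" using at \<open>0 < t\<close> by (subst ln_le_cancel_iff) auto
    moreover have "ln (a * exp r) \<le> ln t" using at \<open>0 < t\<close> \<open>0 < a * exp r\<close>
      by (subst ln_le_cancel_iff) auto
    ultimately show ?case using t \<open>0 < t\<close> by (simp add: elog_def)
  qed
  have int: "integrable M ?L"
  proof (rule Bochner_Integration.integrable_bound)
    show "integrable M (\<lambda>\<omega>. \<bar>ln (a * exp r)\<bar> + \<bar>l\<bar> + \<bar>Fp \<omega>\<bar>)" using Fp by auto
    show "AE \<omega> in M. norm (?L \<omega>) \<le> norm (\<bar>ln (a * exp r)\<bar> + \<bar>l\<bar> + \<bar>Fp \<omega>\<bar>)"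
      using both by eventually_elim auto
  qed measurable
  show "g_fun M T pp pm r = ereal (integral\<^sup>L M ?L)"
    unfolding g_fun_def using both by (intro eexpect_eq_integral int) (auto elim: eventually_mono)
  have "integral\<^sup>L M ?L \<le> (\<integral>\<omega>. - l - Fp \<omega> \<partial>M)"
    using both Fp by (intro integral_mono_AE int) (auto elim: eventually_mono)
  also have "\<dots> = - l" using Fp by (simp add: prob_space)
  finally show "integral\<^sup>L M ?L \<le> - l" .
qed

theorem I_rate_eq:
  assumes "0 \<le> x"
  shows "I_rate M T pp pm x =
    Sup {ereal r - ereal x * g_fun M T pp pm r | r. g_fun M T pp pm r < \<infinity>}" (is "_ = ?J")
proof (rule antisym)
  show "?J \<le> I_rate M T pp pm x"
  proof (rule Sup_least, clarify)
    fix r assume "g_fun M T pp pm r < \<infinity>"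
    then obtain l where l: "g_fun M T pp pm r = ereal (- l)" "Lambda M T pp pm l \<le> ereal (- r)"
      by (rule Lambda_le_of_g_finite)
    have "ereal r - ereal x * g_fun M T pp pm r = ereal (l * x) - ereal (- r)"
      by (simp add: l algebra_simps)
    also have "\<dots> \<le> ereal (l * x) - Lambda M T pp pm l"
      using l by (intro ereal_minus_mono) auto
    also have "\<dots> \<le> I_rate M T pp pm x" unfolding I_rate_def by (rule SUP_upper) simp
    finally show "ereal r - ereal x * g_fun M T pp pm r \<le> I_rate M T pp pm x" .
  qed
  show "I_rate M T pp pm x \<le> ?J"
    unfolding I_rate_def
  proof (rule SUP_least)
    fix l
    let ?f = "\<lambda>F \<omega>. ereal (ln (pp \<omega> * exp (l + fst F \<omega>) + pm \<omega> * exp (- l + snd F \<omega>)))"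
    \<comment> \<open>The inequality is rearranged into a lower bound for each candidate
      \<open>F\<close>, so that the infimum defining \<open>Lambda\<close> can be taken.\<close>
    have "ereal (l * x) - ?J \<le> esssup M (?f F)" if F: "F \<in> class_K M T" for F
    proof (cases "esssup M (?f F)")
      case (real c)
      obtain Fp Fm where F_eq: "F = (Fp, Fm)" by (cases F)
      \<comment> \<open>The choice \<open>r = - c\<close> is the largest \<open>r\<close> that this
        pair allows.\<close>
      have "AE \<omega> in M. ln (pp \<omega> * exp (l + Fp \<omega>) + pm \<omega> * exp (- l + Fm \<omega>)) \<le> - (- c)"
        using esssup_AE[of "?f F" M] unfolding real by (simp add: F_eq)
      with F obtain m where m: "g_fun M T pp pm (- c) = ereal m" "m \<le> - l"
        unfolding F_eq by (rule g_fun_le_of_class_K)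
      have "ereal (- c) - ereal x * ereal m \<le> ?J"
        using m by (intro Sup_upper) (auto intro!: exI[of _ "- c"])
      \<comment> \<open>The sign of \<open>x\<close> enters here.\<close>
      moreover have "x * m \<le> x * (- l)" using m assms by (intro mult_left_mono) auto
      ultimately have "ereal (l * x - c) \<le> ?J"
        by (intro order_trans[OF _ \<open>ereal (- c) - ereal x * ereal m \<le> ?J\<close>]) (simp add: mult.commute)
      then show ?thesis unfolding real by (cases ?J) auto
    next
      case MInf
      \<comment> \<open>A real-valued function cannot be minus infinity almost everywhere on a
        probability space.\<close>
      have "AE \<omega> in M. False"
        using esssup_AE[of "?f F" M] unfolding MInf by simp
      then show ?thesis by simp
    qed auto
    then have "ereal (l * x) - ?J \<le> Lambda M T pp pm l"
      unfolding Lambda_def by (intro INF_greatest) auto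
    \<comment> \<open>Infinite values need separate treatment: if \<open>?J\<close> is minus
      infinity, then \<open>Lambda\<close> is infinite.\<close>
    then show "ereal (l * x) - Lambda M T pp pm l \<le> ?J"
      by (cases ?J; cases "Lambda M T pp pm l") (auto simp: algebra_simps)
  qed
qed

end

section \<open>Reflection\<close>

text \<open>Composing the relation between \<open>Fp\<close> and \<open>Fm\<close> with the inverse,
  or with \<open>T\<close>, exchanges their roles.\<close>

lemma class_K_reflect:
  assumes "invertible_mp M T"
  shows "(Fp, Fm) \<in> class_K M T \<longleftrightarrow> (Fm, Fp) \<in> class_K M (the_inv_into (space M) T)"
proof -
  let ?S = "the_inv_into (space M) T"
  note D = invertible_mpD[OF assms]
  have "(AE \<omega> in M. Fp \<omega> + Fm (T \<omega>) = 0) \<longleftrightarrow> (AE \<omega> in M. Fm \<omega> + Fp (?S \<omega>) = 0)"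
  proof
    assume "AE \<omega> in M. Fp \<omega> + Fm (T \<omega>) = 0"
    from AE_comp_preserving[OF D(2,4) this] AE_space show "AE \<omega> in M. Fm \<omega> + Fp (?S \<omega>) = 0"
      by eventually_elim (simp add: D(6) add.commute)
  next
    assume "AE \<omega> in M. Fm \<omega> + Fp (?S \<omega>) = 0"
    from AE_comp_preserving[OF D(1,3) this] AE_space show "AE \<omega> in M. Fp \<omega> + Fm (T \<omega>) = 0"
      by eventually_elim (simp add: D(5) add.commute)
  qed
  then show ?thesis by (auto simp: class_K_def)
qed

lemma Lambda_reflect:
  assumes "invertible_mp M T"
  shows "Lambda M T pp pm l = Lambda M (the_inv_into (space M) T) pm pp (- l)"
proof -
  have K: "class_K M (the_inv_into (space M) T) = prod.swap ` class_K M T"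
    using class_K_reflect[OF assms] by (auto simp: image_iff Bex_def)
  show ?thesis unfolding Lambda_def K by (simp add: image_image add.commute)
qed

text \<open>The supremum runs over all real \<open>l\<close>, so \<open>l\<close> may be replaced by
  \<open>- l\<close>, which changes the sign of \<open>x\<close>.\<close>

lemma I_rate_reflect:
  assumes "invertible_mp M T"
  shows "I_rate M T pp pm x = I_rate M (the_inv_into (space M) T) pm pp (- x)"
proof -
  have "(SUP l. ereal (l * x) - Lambda M T pp pm l)
      = (SUP l\<in>range uminus. ereal (l * x) - Lambda M T pp pm l)"
    by simp
  then show ?thesis
    unfolding I_rate_def image_image Lambda_reflect[OF assms] by simp
qed

lemma h_fun_reflect:
  assumes "invertible_mp M T"
  shows "h_fun M T pp pm r = g_fun M (the_inv_into (space M) T) pm pp r"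
proof -
  let ?S = "the_inv_into (space M) T"
  have "hit_prob M T pp pm (- 1) \<omega> n = hit_prob M ?S pm pp 1 \<omega> n" if "\<omega> \<in> space M" for \<omega> n
    using fpp_reflect[of "\<lambda>k. pm (Tpow M T k \<omega>)" "\<lambda>k. pp (Tpow M T k \<omega>)" "- 1" n 0]
    by (simp add: hit_prob_eq_fpp Tpow_inv[OF assms that])
  then have "hit_mgf M T pp pm (- 1) \<omega> r = hit_mgf M ?S pm pp 1 \<omega> r" if "\<omega> \<in> space M" for \<omega>
    using that by (simp add: hit_mgf_def)
  then show ?thesis
    unfolding h_fun_def g_fun_def eexpect_def by (simp cong: nn_integral_cong)
qed

theorem theorem5p4:
  fixes M :: "'w measure" and T :: "'w \<Rightarrow> 'w" and pp pm :: "'w \<Rightarrow> real"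
    and a b x :: real
  assumes "prob_space M"
    and "invertible_mp M T" and "ergodic M T"
    and "pp \<in> borel_measurable M" and "pm \<in> borel_measurable M"
    and "\<And>\<omega>. \<omega> \<in> space M \<Longrightarrow> 0 \<le> pp \<omega> \<and> pp \<omega> \<le> 1" and "\<And>\<omega>. \<omega> \<in> space M \<Longrightarrow> 0 \<le> pm \<omega> \<and> pm \<omega> \<le> 1"
    and "\<And>\<omega>. \<omega> \<in> space M \<Longrightarrow> pp \<omega> + pm \<omega> = 1"
    and "0 < a" and "b < 1"
    and "AE \<omega> in M. a \<le> pp \<omega> \<and> pp \<omega> \<le> b \<and> a \<le> pm \<omega> \<and> pm \<omega> \<le> b"
    and "(\<integral>\<omega>. ln (pm \<omega> / pp \<omega>) \<partial>M) \<le> 0"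
    and "-1 \<le> x" and "x \<le> 1"
  shows "I_rate M T pp pm x = J_rate M T pp pm x"
proof (cases "0 \<le> x")
  case True
  interpret random_environment M T pp pm a
    using assms by (auto simp: random_environment_def random_environment_axioms_def)
  show ?thesis using I_rate_eq[OF True] True by (simp add: J_rate_def)
next
  case False
  \<comment> \<open>The mirrored environment has \<open>pm\<close> as its right-step probability,
    and the result for it is applied at \<open>- x\<close>.\<close>
  interpret random_environment M "the_inv_into (space M) T" pm pp a
    using assms invertible_mp_inverse[of M T]
    by (auto simp: random_environment_def random_environment_axioms_def)
  have "I_rate M T pp pm x = Sup {ereal r - ereal (- x) * h_fun M T pp pm r | r.
      h_fun M T pp pm r < \<infinity>}"
    using I_rate_eq[of "- x"] False
    unfolding I_rate_reflect[OF assms(2), of pp pm x] h_fun_reflect[OF assms(2)] by simp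
  also have "\<dots> = J_rate M T pp pm x"
    using False by (simp add: J_rate_def minus_ereal_def flip: uminus_ereal.simps(1))
  finally show ?thesis .
qed

end
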